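(* Let $(\mathfrak{S},\mathfrak{C})$ be a KCBS-system, i.e. $\mathfrak{S}=\{(V_i,W_{i\oplus_5 1}):i\in\{1,\ldots,5\}\}$ and $\mathfrak{C}=\{\{V_i,W_i\}:i\in\{1,\ldots,5\}\}$. Then $$\Delta_0(\mathfrak{C})=\frac12\sum_{i=1}^5|\langle V_i\rangle-\langle W_i\rangle|,\qquad \Delta_{\min}(\mathfrak{S},\mathfrak{C})=\frac12\max\Big(2\Delta_0(\mathfrak{C}),\ \mathsf{s}_{odd}\big(\langle V_iW_{i\oplus_5 1}\rangle:i\in\{1,\ldots,5\}\big)-3\Big).$$ Consequently $$\mathsf{CNTX}(\mathfrak{S},\mathfrak{C})=\frac12\max\Big(0,\ \mathsf{s}_{odd}\big(\langle V_iW_{i\oplus_5 1}\rangle:i\in\{1,\ldots,5\}\big)-3-\sum_{i=1}^5|\langle V_i\rangle-\langle W_i\rangle|\Big),$$ and the system has a noncontextual description if and only if $$\mathsf{s}_{odd}\big(\langle V_iW_{i\oplus_5 1}\rangle:i\in\{1,\ldots,5\}\big)\le 3+\sum_{i=1}^5|\langle V_i\rangle-\langle W_i\rangle|.$$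
   Context: $\oplus_5$ denotes cyclic addition on $\{1,\ldots,5\}$ ($i\oplus_5 1=i+1$ for $i<5$, $5\oplus_5 1=1$). All $V_i,W_i$ are $\pm1$-valued random variables. Each pair $(V_i,W_{i\oplus_5 1})$ is jointly distributed, but variables in different pairs are stochastically unrelated (have no given joint distribution); in particular $V_i$ and $W_i$ are never jointly distributed. $\langle\cdot\rangle$ denotes expectation; $\langle V_iW_{i\oplus_5 1}\rangle$ is computed from the given joint distribution of the pair. A coupling of random variables $A,B$ is a jointly distributed pair $(A^*,B^* )$ with $A^*\sim A$, $B^*\sim B$; it is maximal if $\Pr[A^*=B^*]$ is the largest possible over all couplings. A coupling $S$ of $\mathfrak{S}$ is a jointly distributed 10-tuple $(V_1^*,\ldots,V_5^*,W_1^*,\ldots,W_5^* )$ with $(V_i^*,W_{i\oplus_5 1}^* )$ distributed as $(V_i,W_{i\oplus_5 1})$ for each $i$. The system has a (maximally) noncontextual description if some coupling $S$ has each $(V_i^*,W_i^* )$ a maximal coupling of $V_i,W_i$. $\Delta_0(\mathfrak{C})=\frac12\sum_i|\langle V_i\rangle-\langle W_i\rangle|$; $\Delta_{\min}(\mathfrak{S},\mathfrak{C})$ is the infimum over all couplings $S$ of $\sum_{i=1}^5\Pr[V_i^*\ne W_i^*]$; $\mathsf{CNTX}(\mathfrak{S},\mathfrak{C})=\Delta_{\min}(\mathfrak{S},\mathfrak{C})-\Delta_0(\mathfrak{C})$. For reals $a_1,\ldots,a_m$, $\mathsf{s}_{odd}(a_1,\ldots,a_m)$ is the maximum of $\sum_{i=1}^m(\pm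 a_i)$ over all sign choices with an odd number of minus signs. *)

theory Defs
  imports "HOL-Probability.Probability"
begin

text \<open>KCBS systems. Indices range over {1..5}. The system is given by five joint
distributions P i of the pairs (V_i, W_{i (+) 1}), as pmfs on int x int supported
on {-1,1} x {-1,1}.\<close>

definition cyc5 :: "nat \<Rightarrow> nat" where
  "cyc5 i = (if i < 5 then i + 1 else 1)"

definition cyc5_pred :: "nat \<Rightarrow> nat" where
  "cyc5_pred i = (if i = 1 then 5 else i - 1)"

definition kcbs_system :: "(nat \<Rightarrow> (int \<times> int) pmf) \<Rightarrow> bool" where
  "kcbs_system P \<longleftrightarrow> (\<forall>i\<in>{1..5}. set_pmf (P i) \<subseteq> {-1, 1} \<times> {-1, 1})"

text \<open>Distribution of V_i and of W_i (W_i belongs to the pair with index cyc5_pred i).\<close>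
definition Vdist :: "(nat \<Rightarrow> (int \<times> int) pmf) \<Rightarrow> nat \<Rightarrow> int pmf" where
  "Vdist P i = map_pmf fst (P i)"

definition Wdist :: "(nat \<Rightarrow> (int \<times> int) pmf) \<Rightarrow> nat \<Rightarrow> int pmf" where
  "Wdist P i = map_pmf snd (P (cyc5_pred i))"

definition expec :: "int pmf \<Rightarrow> real" where
  "expec d = measure_pmf.expectation d real_of_int"

definition prod_expec :: "(nat \<Rightarrow> (int \<times> int) pmf) \<Rightarrow> nat \<Rightarrow> real" where
  "prod_expec P i = measure_pmf.expectation (P i) (\<lambda>(x, y). real_of_int (x * y))"

definition is_coupling :: "('a \<times> 'b) pmf \<Rightarrow> 'a pmf \<Rightarrow> 'b pmf \<Rightarrow> bool" where
  "is_coupling Q a b \<longleftrightarrow> map_pmf fst Q = a \<and> map_pmf snd Q = b"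

definition is_maximal_coupling :: "('a \<times> 'a) pmf \<Rightarrow> 'a pmf \<Rightarrow> 'a pmf \<Rightarrow> bool" where
  "is_maximal_coupling Q a b \<longleftrightarrow> is_coupling Q a b \<and>
     (\<forall>Q'. is_coupling Q' a b \<longrightarrow>
        measure_pmf.prob Q' {x. fst x = snd x} \<le> measure_pmf.prob Q {x. fst x = snd x})"

text \<open>A coupling of the system: a joint distribution of (V_1..V_5, W_1..W_5), represented
as a pmf on pairs of functions (v, w) (only indices 1..5 matter), such that each
(v i, w (cyc5 i)) is distributed as P i.\<close>
definition system_coupling ::
  "(nat \<Rightarrow> (int \<times> int) pmf) \<Rightarrow> ((nat \<Rightarrow> int) \<times> (nat \<Rightarrow> int)) pmf \<Rightarrow> bool" where
  "system_coupling P S \<longleftrightarrow>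
     (\<forall>i\<in>{1..5}. map_pmf (\<lambda>(v, w). (v i, w (cyc5 i))) S = P i)"

definition noncontextual :: "(nat \<Rightarrow> (int \<times> int) pmf) \<Rightarrow> bool" where
  "noncontextual P \<longleftrightarrow> (\<exists>S. system_coupling P S \<and>
     (\<forall>i\<in>{1..5}. is_maximal_coupling (map_pmf (\<lambda>(v, w). (v i, w i)) S)
                                        (Vdist P i) (Wdist P i)))"

definition Delta0 :: "(nat \<Rightarrow> (int \<times> int) pmf) \<Rightarrow> real" where
  "Delta0 P = (1/2) * (\<Sum>i=1..5. \<bar>expec (Vdist P i) - expec (Wdist P i)\<bar>)"

definition Delta_min :: "(nat \<Rightarrow> (int \<times> int) pmf) \<Rightarrow> real" where
  "Delta_min P = (INF S\<in>{S. system_coupling P S}.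
      (\<Sum>i=1..5. measure_pmf.prob S {x. fst x i \<noteq> snd x i}))"

definition CNTX :: "(nat \<Rightarrow> (int \<times> int) pmf) \<Rightarrow> real" where
  "CNTX P = Delta_min P - Delta0 P"

definition s_odd5 :: "(nat \<Rightarrow> real) \<Rightarrow> real" where
  "s_odd5 a = Max ((\<lambda>M. \<Sum>i=1..5. (if i \<in> M then - a i else a i))
                    ` {M. M \<subseteq> {1..5} \<and> odd (card M)})"

end

theory Submission
  imports Defs
begin

text \<open>The ten variables form a cycle \<open>W 1, V 1, W 2, V 2, ..., W 5, V 5\<close> whose edges are alternately the free
  pairs \<open>(V i, W i)\<close> and the prescribed pairs \<open>(V i, W (i + 1))\<close>.

  Lower bound: at every sample point the ten products along the edges, with an odd number of signs
  flipped, have product \<open>-1\<close> and hence sum at most 8. Taking expectations bounds the expected number of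
  mismatches from below by \<open>(s_odd - 3) / 2\<close>; the bound by \<open>Delta0\<close> holds edge by edge.

  Attainment: three \<open>\<plusminus>1\<close> variables with prescribed pair distributions have a joint distribution iff
  their correlations satisfy the triangle inequalities, and such triples can be glued along a common
  pair. By induction on the length of the chain starting in \<open>W 1\<close>, every correlation \<open>x\<close> of its end
  points and every cost \<open>D\<close> allowed by the lower bound is realised. Closing the cycle is the case where
  \<open>x\<close> is the prescribed correlation of \<open>(V 5, W 1)\<close>.\<close>

section \<open>Correlation inequalities\<close>

text \<open>The inequalities of the cut polytope of a triangle, for correlations of \<open>\<plusminus>1\<close> variables. With the
  constant variable 1 as one of the three vertices they also characterise the possible means
  \<open>x\<close>, \<open>y\<close> and correlation \<open>z\<close> of a single pair.\<close>

definition cut_triangle :: "real \<Rightarrow> real \<Rightarrow> real \<Rightarrow> bool" where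
  "cut_triangle x y z \<longleftrightarrow> \<bar>x + y\<bar> \<le> 1 + z \<and> \<bar>x - y\<bar> \<le> 1 - z"

lemma cut_triangle_iff:
  "cut_triangle x y z \<longleftrightarrow> x + y \<le> 1 + z \<and> - x - y \<le> 1 + z \<and> x - y \<le> 1 - z \<and> y - x \<le> 1 - z"
  unfolding cut_triangle_def by linarith

lemma cut_triangleD:
  assumes "cut_triangle x y z"
  shows "x + y \<le> 1 + z" "- x - y \<le> 1 + z" "x - y \<le> 1 - z" "y - x \<le> 1 - z"
    "x \<le> 1" "- 1 \<le> x" "y \<le> 1" "- 1 \<le> y" "z \<le> 1" "- 1 \<le> z"
  using assms unfolding cut_triangle_iff by linarith+

lemma cut_triangle_commute: "cut_triangle x y z \<longleftrightarrow> cut_triangle y x z"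
  by (simp add: cut_triangle_def add.commute abs_minus_commute)

text \<open>The largest lower bound lies below every upper bound. This is the elimination step of
  the three existence proofs below, where the constraints on one unknown are sorted into lower and
  upper bounds.\<close>

lemma finite_sets_separated:
  fixes L U :: "'a::linorder set"
  assumes "finite L" "L \<noteq> {}" "\<And>l u. l \<in> L \<Longrightarrow> u \<in> U \<Longrightarrow> l \<le> u"
  shows "\<exists>x. (\<forall>l\<in>L. l \<le> x) \<and> (\<forall>u\<in>U. x \<le> u)"
  using assms by (intro exI[of _ "Max L"]) auto

text \<open>The eight weights below are those of a triple with free third moment \<open>t\<close>. The bounds on \<open>t\<close> come
  from atoms of opposite parity, which differ either in one coordinate (a pair condition) or in all
  three (a triangle condition).\<close>

lemma third_moment_exists:
  fixes a b c x y z :: real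
  assumes "cut_triangle a b x" "cut_triangle b c y" "cut_triangle a c z" "cut_triangle x y z"
  shows "\<exists>t. \<forall>\<alpha>\<in>{-1,1}. \<forall>\<beta>\<in>{-1,1}. \<forall>\<gamma>\<in>{-1,1}.
     0 \<le> 1 + a * \<alpha> + b * \<beta> + c * \<gamma> + x * (\<alpha> * \<beta>) + y * (\<beta> * \<gamma>) + z * (\<alpha> * \<gamma>) + t * (\<alpha> * \<beta> * \<gamma>)"
proof -
  note as = assms[THEN cut_triangleD(1)] assms[THEN cut_triangleD(2)] assms[THEN cut_triangleD(3)]
    assms[THEN cut_triangleD(4)]
  \<comment> \<open>Atoms with \<alpha>\<beta>\<gamma> = 1 bound \<open>t\<close> from below, those
    with \<alpha>\<beta>\<gamma> = -1 from above.\<close>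
  let ?L = "{- (1 + a + b + c + x + y + z), - (1 + a - b - c - x + y - z),
     - (1 - a + b - c - x - y + z), - (1 - a - b + c + x - y - z)}"
  let ?U = "{1 - a - b - c + x + y + z, 1 - a + b + c - x + y - z,
     1 + a - b + c - x - y + z, 1 + a + b - c + x - y - z}"
  have "\<exists>t. (\<forall>l\<in>?L. l \<le> t) \<and> (\<forall>u\<in>?U. t \<le> u)"
  proof (rule finite_sets_separated)
    show "l \<le> u" if "l \<in> ?L" "u \<in> ?U" for l u
      using that by (elim insertE emptyE; insert as; linarith)
  qed (rule finite.intros insert_not_empty)+
  then obtain t where L: "\<forall>l\<in>?L. l \<le> t" and U: "\<forall>u\<in>?U. t \<le> u" by (elim exE conjE)
  have tb: "- (1 + a + b + c + x + y + z) \<le> t" "- (1 + a - b - c - x + y - z) \<le> t"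
     "- (1 - a + b - c - x - y + z) \<le> t" "- (1 - a - b + c + x - y - z) \<le> t"
     "t \<le> 1 - a - b - c + x + y + z" "t \<le> 1 - a + b + c - x + y - z"
     "t \<le> 1 + a - b + c - x - y + z" "t \<le> 1 + a + b - c + x - y - z"
    by (rule bspec[OF L] bspec[OF U]; (rule insertI1 insertI2)+)+
  show ?thesis by (intro exI[of _ t] ballI, elim insertE emptyE; hypsubst; insert tb; linarith)
qed

text \<open>The next two lemmas lengthen a chain starting in a variable of mean \<open>a\<close> by one edge, first with a
  prescribed correlation \<open>f\<close>, then with a correlation \<open>z\<close> that may be chosen at the cost \<open>(1 - z) / 2\<close>.
  Given the target correlation \<open>y\<close> of the end points of the longer chain, they find a correlation \<open>x\<close>
  for the shorter one, by Fourier-Motzkin elimination. The parameters \<open>od\<close> and \<open>ev\<close> stand for the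
  maximal signed sums of the prescribed correlations with an odd and even number of minus signs.\<close>

lemma extend_by_prescribed_edge:
  fixes a b c f y D D0 m ev od :: real
  assumes "cut_triangle b c f" "cut_triangle a c y"
    and "D0 \<le> D" "0 \<le> D"
    and "od + ev \<le> 2 * m"
    and "od + \<bar>a + b\<bar> - 1 \<le> 2 * D0 + m" "ev + \<bar>a - b\<bar> - 1 \<le> 2 * D0 + m"
    and "max (od + f) (ev - f) + y \<le> 2 * D + (m + 1)"
    and "max (ev + f) (od - f) - y \<le> 2 * D + (m + 1)"
  shows "\<exists>x. cut_triangle a b x \<and> cut_triangle x f y \<and> od + x \<le> 2 * D + m \<and> ev - x \<le> 2 * D + m"
proof -
  note ab = cut_triangleD[OF assms(1)] cut_triangleD[OF assms(2)]
  define r u where "r = \<bar>a + b\<bar>" "u = \<bar>a - b\<bar>"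
  note defs = this
  have tri: "r + u \<le> 2" "r \<le> 2 - y + f" "r \<le> 2 + y - f" "u \<le> 2 - y - f" "u \<le> 2 + y + f"
    unfolding defs using ab by linarith+
  have mx: "od + f + y \<le> 2 * D + (m + 1)" "ev - f + y \<le> 2 * D + (m + 1)"
     "ev + f - y \<le> 2 * D + (m + 1)" "od - f - y \<le> 2 * D + (m + 1)"
    using assms(8,9) by linarith+
  note as = assms(3-7)[folded defs] mx tri ab
  \<comment> \<open>In each set the first entry comes from \<open>cut_triangle a b x\<close>, the
    second from the budget \<open>D\<close>, the last two from
    \<open>cut_triangle x f y\<close>.\<close>
  let ?L = "{r - 1, ev - 2 * D - m, y + f - 1, - y - f - 1}"
  let ?U = "{1 - u, 2 * D + m - od, 1 - y + f, 1 + y - f}"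
  have "\<exists>t. (\<forall>l\<in>?L. l \<le> t) \<and> (\<forall>u\<in>?U. t \<le> u)"
  proof (rule finite_sets_separated)
    show "l \<le> u" if "l \<in> ?L" "u \<in> ?U" for l u
      using that by (elim insertE emptyE; insert as; linarith)
  qed (rule finite.intros insert_not_empty)+
  then obtain x where L: "\<forall>l\<in>?L. l \<le> x" and U: "\<forall>u\<in>?U. x \<le> u" by (elim exE conjE)
  have "r - 1 \<le> x" "ev - 2 * D - m \<le> x" "y + f - 1 \<le> x" "- y - f - 1 \<le> x"
     "x \<le> 1 - u" "x \<le> 2 * D + m - od" "x \<le> 1 - y + f" "x \<le> 1 + y - f"
    by (rule bspec[OF L] bspec[OF U]; (rule insertI1 insertI2)+)+
  then have "cut_triangle a b x" "cut_triangle x f y" "od + x \<le> 2 * D + m" "ev - x \<le> 2 * D + m"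
    unfolding cut_triangle_def defs by linarith+
  then show ?thesis by blast
qed

lemma extend_by_free_edge:
  fixes a b c y D D0 m ev od :: real
  assumes "cut_triangle a c y" "\<bar>b\<bar> \<le> 1"
    and "D0 + \<bar>b - c\<bar> / 2 \<le> D" "0 \<le> D0"
    and "od + ev \<le> 2 * m"
    and "od + \<bar>a + b\<bar> - 1 \<le> 2 * D0 + m" "ev + \<bar>a - b\<bar> - 1 \<le> 2 * D0 + m"
    and "od + y \<le> 2 * D + m" "ev - y \<le> 2 * D + m"
  shows "\<exists>x z. cut_triangle a b x \<and> cut_triangle b c z \<and> cut_triangle x z y
           \<and> 2 * D0 + 1 - z \<le> 2 * D
           \<and> od + x + 1 - z \<le> 2 * D + m \<and> ev - x + 1 - z \<le> 2 * D + m"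
proof -
  define p q r u where "p = \<bar>b - c\<bar>" "q = \<bar>b + c\<bar>" "r = \<bar>a + b\<bar>" "u = \<bar>a - b\<bar>"
  note defs = this
  note ac = cut_triangleD[OF assms(1)]
  have c: "\<bar>c\<bar> \<le> 1" using ac(7,8) by linarith
  have t1: "p + q \<le> 2" unfolding defs using assms(2) c by linarith
  have a: "\<bar>a\<bar> \<le> 1" using ac(5,6) by linarith
  have t2: "r + u \<le> 2" unfolding defs using assms(2) a by linarith
  have t3: "r \<le> 1 + y + p" "u \<le> 1 - y + p" "p \<le> r + 1 + y" "p \<le> u + 1 - y"
    "r + p \<le> 3 - y" "u + p \<le> 3 + y"
  proof -
    have "\<bar>a + b\<bar> \<le> \<bar>a + c\<bar> + \<bar>b - c\<bar>" "\<bar>a - b\<bar> \<le> \<bar>a - c\<bar> + \<bar>b - c\<bar>"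
      "\<bar>b - c\<bar> \<le> \<bar>a + b\<bar> + \<bar>a + c\<bar>" "\<bar>b - c\<bar> \<le> \<bar>a - b\<bar> + \<bar>a - c\<bar>" by linarith+
    moreover have "\<bar>a + b\<bar> + \<bar>b - c\<bar> \<le> 2 + \<bar>a - c\<bar>" "\<bar>a - b\<bar> + \<bar>b - c\<bar> \<le> 2 + \<bar>a + c\<bar>"
      using assms(2) c a by linarith+
    ultimately show "r \<le> 1 + y + p" "u \<le> 1 - y + p" "p \<le> r + 1 + y" "p \<le> u + 1 - y"
       "r + p \<le> 3 - y" "u + p \<le> 3 + y"
      using assms(1) unfolding defs cut_triangle_def by argo+
  qed
  have t4: "0 \<le> p" "0 \<le> q" and t5: "0 \<le> r" "0 \<le> u" by (simp_all add: defs)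
  note ds = assms(3-9)[folded defs] and q2 = t1 t4 and y1 = ac(9,10)
  \<comment> \<open>Here \<open>z\<close> has been eliminated: apart from \<open>r - 1\<close> and
    \<open>1 - u\<close>, each entry says that a lower bound on \<open>z\<close> does not exceed an
    upper bound on \<open>z\<close>. Halves arise where \<open>x\<close> occurs in both with
    opposite signs.\<close>
  let ?L = "{r - 1, y - 2 + q, y - 2 * D + 2 * D0,
    ev - 2 * D + p - m, ev / 2 + y / 2 - D - m / 2, p - 2 - y}"
  let ?U = "{1 - u, y + 2 - q, y + 2 * D - 2 * D0,
    2 * D - p + m - od, D + m / 2 + y / 2 - od / 2, 2 - p - y}"
  have "\<exists>t. (\<forall>l\<in>?L. l \<le> t) \<and> (\<forall>u\<in>?U. t \<le> u)"
  proof (rule finite_sets_separated)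
    show "l \<le> u" if "l \<in> ?L" "u \<in> ?U" for l u
      using that(1)
    proof (elim insertE emptyE)
      assume l: "l = r - 1"
      show ?thesis
        by (insert that(2), elim insertE emptyE; insert l t2 t3(1,5) t1 ds(1,4); linarith)
    next
      assume l: "l = y - 2 + q"
      show ?thesis
        by (insert that(2), elim insertE emptyE; insert l q2 t3(2) y1 ds(1,6); linarith)
    next
      assume l: "l = y - 2 * D + 2 * D0"
      show ?thesis
        by (insert that(2), elim insertE emptyE; insert l q2 t3(2) y1 ds(1,6); linarith)
    next
      assume l: "l = ev - 2 * D + p - m"
      show ?thesis
        by (insert that(2), elim insertE emptyE; insert l q2 t3(4) y1 ds(1-3,5,7); linarith)
    next
      assume l: "l = ev / 2 + y / 2 - D - m / 2"
      show ?thesis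
        by (insert that(2), elim insertE emptyE; insert l q2 t3(2,4) y1 ds(1-3,5-7); linarith)
    next
      assume l: "l = p - 2 - y"
      show ?thesis
        by (insert that(2), elim insertE emptyE; insert l q2 t3(3,6) y1 ds(1,4); linarith)
    qed
  qed (rule finite.intros insert_not_empty)+
  then obtain x where L: "\<forall>l\<in>?L. l \<le> x" and U: "\<forall>u\<in>?U. x \<le> u" by (elim exE conjE)
  have U: "x \<le> 1 - u" "x \<le> y + 2 - q" "x \<le> y + 2 * D - 2 * D0"
    "x \<le> 2 * D - p + m - od" "x \<le> D + m / 2 + y / 2 - od / 2" "x \<le> 2 - p - y"
    and L: "r - 1 \<le> x" "y - 2 + q \<le> x" "y - 2 * D + 2 * D0 \<le> x"
    "ev - 2 * D + p - m \<le> x" "ev / 2 + y / 2 - D - m / 2 \<le> x" "p - 2 - y \<le> x"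
    by (rule bspec[OF L] bspec[OF U]; (rule insertI1 insertI2)+)+
  \<comment> \<open>The largest \<open>z\<close> that the triangles allow is the cheapest choice;
    all remaining constraints bound \<open>z\<close> from below.\<close>
  define z where "z = min (1 - p) (min (1 - x + y) (1 - y + x))"
  have zU: "z \<le> 1 - p" "z \<le> 1 - x + y" "z \<le> 1 - y + x" by (auto simp: z_def)
  have zL: "q - 1 \<le> z" "1 - 2 * D + 2 * D0 \<le> z"
    unfolding z_def min.bounded_iff using t1 ds(1) U(2,3) L(2,3) by linarith+
  moreover have "od + x - 2 * D + 1 - m \<le> z" "ev - x - 2 * D + 1 - m \<le> z"
    unfolding z_def min.bounded_iff using U(4,5) L(4,5) ds(6,7) by linarith+
  moreover have "x + y - 1 \<le> z" "- x - y - 1 \<le> z"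
    unfolding z_def min.bounded_iff using U(1,6) L(1,6) y1 t5 by linarith+
  moreover note zU
  ultimately have "cut_triangle x z y" "2 * D0 + 1 - z \<le> 2 * D"
     "od + x + 1 - z \<le> 2 * D + m" "ev - x + 1 - z \<le> 2 * D + m"
    unfolding cut_triangle_iff by linarith+
  moreover have "cut_triangle a b x" "cut_triangle b c z"
    using U(1) L(1) zU(1) zL(1) unfolding cut_triangle_def defs by linarith+
  ultimately show ?thesis by blast
qed

section \<open>Joint distributions of sign variables\<close>

definition pm1 :: "'a pmf \<Rightarrow> ('a \<Rightarrow> int) \<Rightarrow> bool" where
  "pm1 S X \<longleftrightarrow> (\<forall>s\<in>set_pmf S. X s \<in> {-1, 1})"

definition mean :: "'a pmf \<Rightarrow> ('a \<Rightarrow> int) \<Rightarrow> real" where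
  "mean S X = measure_pmf.expectation S (\<lambda>s. real_of_int (X s))"

definition corr :: "'a pmf \<Rightarrow> ('a \<Rightarrow> int) \<Rightarrow> ('a \<Rightarrow> int) \<Rightarrow> real" where
  "corr S X Y = mean S (\<lambda>s. X s * Y s)"

lemma pm1_mult: "pm1 S X \<Longrightarrow> pm1 S Y \<Longrightarrow> pm1 S (\<lambda>s. X s * Y s)"
  unfolding pm1_def by (metis insert_iff mult_1 mult_minus1 singletonD minus_minus)

lemma pm1_map: "pm1 (map_pmf g S) X \<longleftrightarrow> pm1 S (X \<circ> g)"
  by (auto simp: pm1_def)

lemma mean_map: "mean (map_pmf g S) X = mean S (X \<circ> g)"
  by (simp add: mean_def)

lemma corr_map: "corr (map_pmf g S) X Y = corr S (X \<circ> g) (Y \<circ> g)"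
  by (simp add: corr_def mean_map o_def)

lemma mean_cong: "(\<And>s. s \<in> set_pmf S \<Longrightarrow> X s = Y s) \<Longrightarrow> mean S X = mean S Y"
  unfolding mean_def by (intro integral_cong_AE) (auto simp: AE_measure_pmf_iff)

section \<open>Pair distributions in terms of means and correlations\<close>

lemma integrable_pm1:
  assumes "pm1 S X"
  shows "integrable (measure_pmf S) (\<lambda>s. real_of_int (X s))"
  using assms by (intro measure_pmf.integrable_const_bound[where B = 1])
    (auto simp: pm1_def AE_measure_pmf_iff)

text \<open>On signs the indicator of \<open>X s = \<alpha>\<close> is
  \<open>(1 + \<alpha> * X s) / 2\<close>. The product of two such factors expands into 1,
  \<open>X\<close>, \<open>Y\<close> and \<open>X * Y\<close>, so the two means and the correlation
  determine the pair.\<close>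

lemma prob_pair_eq:
  fixes \<alpha> \<beta> :: int
  assumes X: "pm1 S X" and Y: "pm1 S Y" and "\<alpha> \<in> {-1, 1}" "\<beta> \<in> {-1, 1}"
  shows "pmf (map_pmf (\<lambda>s. (X s, Y s)) S) (\<alpha>, \<beta>) =
    (1 + \<alpha> * mean S X + \<beta> * mean S Y + \<alpha> * \<beta> * corr S X Y) / 4"
proof -
  note [simp] = integrable_pm1[OF X] integrable_pm1[OF Y]
    integrable_pm1[OF pm1_mult[OF X Y], unfolded of_int_mult]
  have "pmf (map_pmf (\<lambda>s. (X s, Y s)) S) (\<alpha>, \<beta>) =
      measure_pmf.expectation S (indicator {s. X s = \<alpha> \<and> Y s = \<beta>})"
    by (simp add: pmf_map vimage_def)
  also have "\<dots> = measure_pmf.expectation S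
      (\<lambda>s. (1 + \<alpha> * X s + \<beta> * Y s + \<alpha> * \<beta> * (X s * Y s)) / 4 :: real)"
  proof (intro integral_cong_AE)
    have "indicator {s. X s = \<alpha> \<and> Y s = \<beta>} s =
        ((1 + \<alpha> * X s + \<beta> * Y s + \<alpha> * \<beta> * (X s * Y s)) / 4 :: real)" if "s \<in> set_pmf S" for s
      using assms(3,4) X[unfolded pm1_def, rule_format, OF that] Y[unfolded pm1_def, rule_format, OF that]
      by auto
    then show "AE s in measure_pmf S. indicator {s. X s = \<alpha> \<and> Y s = \<beta>} s =
        ((1 + \<alpha> * X s + \<beta> * Y s + \<alpha> * \<beta> * (X s * Y s)) / 4 :: real)"
      by (simp add: AE_measure_pmf_iff)
  qed simp_all
  also have "\<dots> = (1 + \<alpha> * mean S X + \<beta> * mean S Y + \<alpha> * \<beta> * corr S X Y) / 4"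
    by (simp add: mean_def corr_def)
  finally show ?thesis .
qed

text \<open>The four inequalities are the nonnegativity of the four atoms.\<close>

lemma cut_triangle_mean_corr:
  assumes "pm1 S X" "pm1 S Y"
  shows "cut_triangle (mean S X) (mean S Y) (corr S X Y)"
proof -
  have "0 \<le> (1 + \<alpha> * mean S X + \<beta> * mean S Y + \<alpha> * \<beta> * corr S X Y) / 4"
    if "\<alpha> \<in> {-1, 1}" "\<beta> \<in> {-1, 1}" for \<alpha> \<beta> :: int
    using prob_pair_eq[OF assms that] pmf_nonneg by metis
  from this[of 1 1] this[of 1 "-1"] this[of "-1" 1] this[of "-1" "-1"]
  show ?thesis by (simp add: cut_triangle_iff)
qed

text \<open>On signs the indicator of a mismatch is \<open>(1 - X s * Y s) / 2\<close>. This
  translates mismatch costs into correlations.\<close>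

lemma prob_neq_eq:
  assumes X: "pm1 S X" and Y: "pm1 S Y"
  shows "measure_pmf.prob S {s. X s \<noteq> Y s} = (1 - corr S X Y) / 2"
proof -
  note [simp] = integrable_pm1[OF pm1_mult[OF X Y], unfolded of_int_mult]
  have "measure_pmf.prob S {s. X s \<noteq> Y s} =
      measure_pmf.expectation S (indicator {s. X s \<noteq> Y s})"
    by simp
  also have "\<dots> = measure_pmf.expectation S (\<lambda>s. (1 - X s * Y s) / 2 :: real)"
  proof (intro integral_cong_AE)
    have "indicator {s. X s \<noteq> Y s} s = ((1 - X s * Y s) / 2 :: real)" if "s \<in> set_pmf S" for s
      using X[unfolded pm1_def, rule_format, OF that] Y[unfolded pm1_def, rule_format, OF that]
      by auto
    then show "AE s in measure_pmf S. indicator {s. X s \<noteq> Y s} s = ((1 - X s * Y s) / 2 :: real)"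
      by (simp add: AE_measure_pmf_iff)
  qed simp_all
  also have "\<dots> = (1 - corr S X Y) / 2"
    by (simp add: mean_def corr_def)
  finally show ?thesis .
qed

lemma pair_distribution_eqI:
  assumes "pm1 S X" "pm1 S Y" "pm1 T X'" "pm1 T Y'"
    and "mean S X = mean T X'" "mean S Y = mean T Y'" "corr S X Y = corr T X' Y'"
  shows "map_pmf (\<lambda>s. (X s, Y s)) S = map_pmf (\<lambda>t. (X' t, Y' t)) T"
proof (rule pmf_eqI)
  fix p :: "int \<times> int"
  obtain \<alpha> \<beta> where p: "p = (\<alpha>, \<beta>)" by (cases p)
  show "pmf (map_pmf (\<lambda>s. (X s, Y s)) S) p = pmf (map_pmf (\<lambda>t. (X' t, Y' t)) T) p"
  proof (cases "\<alpha> \<in> {-1, 1} \<and> \<beta> \<in> {-1, 1}")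
    case True
    then show ?thesis using assms by (simp only: p prob_pair_eq)
  next
    case False
    then have "p \<notin> set_pmf (map_pmf (\<lambda>s. (X s, Y s)) S)" "p \<notin> set_pmf (map_pmf (\<lambda>t. (X' t, Y' t)) T)"
      using assms(1-4) unfolding p pm1_def by auto
    then show ?thesis by (metis pmf_eq_0_set_pmf)
  qed
qed

section \<open>Construction and gluing of triples\<close>

lemma triple_exists:
  assumes "cut_triangle a b x" "cut_triangle b c y" "cut_triangle a c z" "cut_triangle x y z"
  shows "\<exists>T :: (int \<times> int \<times> int) pmf.
    pm1 T fst \<and> pm1 T (fst \<circ> snd) \<and> pm1 T (snd \<circ> snd) \<and>
    mean T fst = a \<and> mean T (fst \<circ> snd) = b \<and> mean T (snd \<circ> snd) = c \<and>
    corr T fst (fst \<circ> snd) = x \<and> corr T (fst \<circ> snd) (snd \<circ> snd) = y \<and> corr T fst (snd \<circ> snd) = z"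
proof -
  obtain t where t: "\<forall>\<alpha>\<in>{-1,1}. \<forall>\<beta>\<in>{-1,1}. \<forall>\<gamma>\<in>{-1,1}.
     0 \<le> 1 + a * \<alpha> + b * \<beta> + c * \<gamma> + x * (\<alpha> * \<beta>) + y * (\<beta> * \<gamma>) + z * (\<alpha> * \<gamma>) + t * (\<alpha> * \<beta> * \<gamma>)"
    using third_moment_exists[OF assms] by (elim exE)
  \<comment> \<open>A Fourier expansion on the sign cube: by orthogonality of the monomials, its
    coefficients are the moments of the distribution.\<close>
  define p :: "int \<times> int \<times> int \<Rightarrow> real" where "p = (\<lambda>(\<alpha>, \<beta>, \<gamma>).
     (1 + a * \<alpha> + b * \<beta> + c * \<gamma> + x * (\<alpha> * \<beta>) + y * (\<beta> * \<gamma>) + z * (\<alpha> * \<gamma>) + t * (\<alpha> * \<beta> * \<gamma>)) / 8)"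
  define L :: "(int \<times> int \<times> int) list" where
    "L = [(1,1,1), (1,1,-1), (1,-1,1), (1,-1,-1), (-1,1,1), (-1,1,-1), (-1,-1,1), (-1,-1,-1)]"
  have wf: "pmf_of_list_wf (map (\<lambda>s. (s, p s)) L)"
  proof (rule pmf_of_list_wfI)
    show "sum_list (map snd (map (\<lambda>s. (s, p s)) L)) = 1"
      by (simp add: L_def p_def add_divide_distrib diff_divide_distrib)
    have "0 \<le> p s" if "s \<in> set L" for s
    proof -
      obtain \<alpha> \<beta> \<gamma> where s: "s = (\<alpha>, \<beta>, \<gamma>)" by (cases s)
      have "\<alpha> \<in> {-1, 1} \<and> \<beta> \<in> {-1, 1} \<and> \<gamma> \<in> {-1, 1}"
        using that unfolding s L_def by auto
      then have "real_of_int \<alpha> \<in> {-1, 1}" "real_of_int \<beta> \<in> {-1, 1}" "real_of_int \<gamma> \<in> {-1, 1}"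
        by auto
      from t[rule_format, OF this] show ?thesis
        unfolding s p_def prod.case by (rule divide_nonneg_pos) simp
    qed
    then show "0 \<le> r" if "r \<in> set (map snd (map (\<lambda>s. (s, p s)) L))" for r
      using that by auto
  qed
  define T where "T = pmf_of_list (map (\<lambda>s. (s, p s)) L)"
  have supp: "set_pmf T \<subseteq> set L"
    using set_pmf_of_list[OF wf] by (simp add: T_def image_image)
  have pT: "pmf T s = p s" if "s \<in> set L" for s
    using that by (auto simp: T_def pmf_pmf_of_list[OF wf]) (auto simp: L_def)
  have E: "mean T X = (\<Sum>s\<in>set L. X s * p s)" for X
    unfolding mean_def using supp pT
    by (subst integral_measure_pmf_real[where A = "set L"]) (auto intro!: sum.cong)
  have "mean T fst = a" "mean T (fst \<circ> snd) = b" "mean T (snd \<circ> snd) = c"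
    "corr T fst (fst \<circ> snd) = x" "corr T (fst \<circ> snd) (snd \<circ> snd) = y" "corr T fst (snd \<circ> snd) = z"
    unfolding corr_def E by (simp_all add: L_def p_def add_divide_distrib diff_divide_distrib)
  moreover have "pm1 T fst" "pm1 T (fst \<circ> snd)" "pm1 T (snd \<circ> snd)"
    using supp by (auto simp: pm1_def L_def)
  ultimately show ?thesis by blast
qed

text \<open>A triple is glued onto \<open>S\<close> along the pair (\<open>X\<close>,
  \<open>Y\<close>). As \<open>S\<close> survives as the first marginal, every moment already
  arranged is kept.\<close>

lemma extend_by_third_variable:
  assumes X: "pm1 S X" and Y: "pm1 S Y" and "cut_triangle (mean S X) c y"
    and "cut_triangle (mean S Y) c f" "cut_triangle (corr S X Y) f y"
  shows "\<exists>S'. map_pmf fst S' = S \<and> pm1 S' snd \<and> mean S' snd = c \<and>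
    corr S' (X \<circ> fst) snd = y \<and> corr S' (Y \<circ> fst) snd = f"
proof -
  from triple_exists[OF cut_triangle_mean_corr[OF X Y] assms(4,3,5)]
  obtain T :: "(int \<times> int \<times> int) pmf" where T: "pm1 T fst" "pm1 T (fst \<circ> snd)" "pm1 T (snd \<circ> snd)"
    "mean T fst = mean S X" "mean T (fst \<circ> snd) = mean S Y" "mean T (snd \<circ> snd) = c"
    "corr T fst (fst \<circ> snd) = corr S X Y" "corr T (fst \<circ> snd) (snd \<circ> snd) = f" "corr T fst (snd \<circ> snd) = y"
    by (elim exE conjE)
  have "map_pmf (\<lambda>s. (X s, Y s)) S = map_pmf (\<lambda>t. (fst t, (fst \<circ> snd) t)) T"
    using X Y T by (intro pair_distribution_eqI) (simp_all add: o_def)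
  \<comment> \<open>Equality of the two pair distributions lifts to a coupling of \<open>S\<close>
    and \<open>T\<close> under which the shared pair agrees on the whole support.\<close>
  then have "rel_pmf (=) (map_pmf (\<lambda>s. (X s, Y s)) S) (map_pmf (\<lambda>t. (fst t, (fst \<circ> snd) t)) T)"
    by (simp only: pmf.rel_eq)
  then have "rel_pmf (\<lambda>s t. (X s, Y s) = (fst t, (fst \<circ> snd) t)) S T"
    by (simp only: pmf.rel_map)
  then obtain pq where pq: "\<And>s t. (s, t) \<in> set_pmf pq \<Longrightarrow> X s = fst t \<and> Y s = fst (snd t)"
    and fst: "map_pmf fst pq = S" and snd: "map_pmf snd pq = T"
    by (elim rel_pmf.cases) auto
  define S' where "S' = map_pmf (\<lambda>(s, t). (s, snd (snd t))) pq"
  have "corr S' (X \<circ> fst) snd = corr pq (fst \<circ> snd) ((snd \<circ> snd) \<circ> snd)"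
    "corr S' (Y \<circ> fst) snd = corr pq ((fst \<circ> snd) \<circ> snd) ((snd \<circ> snd) \<circ> snd)"
    unfolding S'_def corr_map unfolding corr_def using pq by (force intro!: mean_cong)+
  moreover have "mean S' snd = mean pq ((snd \<circ> snd) \<circ> snd)"
    unfolding S'_def mean_map by (intro mean_cong) auto
  moreover have "pm1 S' snd" using T(3) unfolding snd[symmetric] by (auto simp: S'_def pm1_def)
  moreover have "map_pmf fst S' = S"
    unfolding S'_def fst[symmetric] by (simp add: map_pmf_comp case_prod_beta')
  ultimately show ?thesis
    using T(6,8,9) unfolding snd[symmetric] mean_map corr_map by (intro exI[of _ S']) simp
qed

lemma pair_exists:
  assumes "cut_triangle a b x"
  shows "\<exists>T :: (int \<times> int) pmf. pm1 T fst \<and> pm1 T snd \<and> mean T fst = a \<and> mean T snd = b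
    \<and> corr T fst snd = x"
proof -
  \<comment> \<open>The third variable gets the moments of an independent fair sign and is then
    forgotten.\<close>
  have "cut_triangle b 0 0" "cut_triangle a 0 0" "cut_triangle x 0 0"
    using cut_triangleD[OF assms] by (auto simp: cut_triangle_def)
  from triple_exists[OF assms this]
  obtain T :: "(int \<times> int \<times> int) pmf" where "pm1 T fst" "pm1 T (fst \<circ> snd)"
    "mean T fst = a" "mean T (fst \<circ> snd) = b" "corr T fst (fst \<circ> snd) = x"
    by (elim exE conjE)
  then show ?thesis
    by (intro exI[of _ "map_pmf (\<lambda>t. (fst t, fst (snd t))) T"])
      (simp add: pm1_map mean_map corr_map o_def)
qed

section \<open>Couplings of chains\<close>

text \<open>The value \<open>-2\<close> replaces the maximum over the empty set; it is small enough never to matter for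
  summands in \<open>[-1, 1]\<close>.\<close>

fun odd_max even_max :: "(nat \<Rightarrow> real) \<Rightarrow> nat \<Rightarrow> real" where
  "odd_max f 0 = -2"
| "odd_max f (Suc n) = max (odd_max f n + f (Suc n)) (even_max f n - f (Suc n))"
| "even_max f 0 = 0"
| "even_max f (Suc n) = max (even_max f n + f (Suc n)) (odd_max f n - f (Suc n))"

text \<open>An odd and an even sign choice differ at some index, where the two summands cancel;
  every other index contributes at most 2. The value -2 makes the last bound an equality at
  \<open>n = 0\<close>.\<close>

lemma odd_max_even_max_bounds:
  assumes "\<And>i. i \<in> {1..n} \<Longrightarrow> \<bar>f i\<bar> \<le> 1"
  shows "odd_max f n \<le> n \<and> even_max f n \<le> n \<and> odd_max f n + even_max f n \<le> 2 * (real n - 1)"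
  using assms
proof (induction n)
  case (Suc n)
  then have "odd_max f n \<le> n" "even_max f n \<le> n" "odd_max f n + even_max f n \<le> 2 * real n - 2"
    and "\<bar>f (Suc n)\<bar> \<le> 1"
    by auto
  then show ?case by (auto simp: max_def)
qed simp

text \<open>Triangle inequality for means: passing from \<open>b\<close> to \<open>c\<close> costs
  at most \<open>1 - f\<close>, which offsets \<open>+ f\<close>, and passing from \<open>b\<close>
  to \<open>- c\<close> costs at most \<open>1 + f\<close>, which offsets
  \<open>- f\<close>.\<close>

lemma odd_max_even_max_step:
  fixes od ev a b c f K :: real
  assumes "od + \<bar>a + b\<bar> \<le> K" "ev + \<bar>a - b\<bar> \<le> K" "cut_triangle b c f"
  shows "max (od + f) (ev - f) + \<bar>a + c\<bar> \<le> K + 1"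
    "max (ev + f) (od - f) + \<bar>a - c\<bar> \<le> K + 1"
  using assms unfolding cut_triangle_def by linarith+

text \<open>The analogue of \<open>Delta0\<close> for a chain. The argument \<open>n\<close> counts
  prescribed edges, so there are \<open>Suc n\<close> free pairs.\<close>

definition chain_gap :: "(nat \<Rightarrow> real) \<Rightarrow> (nat \<Rightarrow> real) \<Rightarrow> nat \<Rightarrow> real" where
  "chain_gap a b n = (\<Sum>i=1..Suc n. \<bar>a i - b i\<bar>) / 2"

lemma chain_gap_Suc: "chain_gap a b (Suc n) = chain_gap a b n + \<bar>a (Suc (Suc n)) - b (Suc (Suc n))\<bar> / 2"
  by (simp add: chain_gap_def add_divide_distrib)

lemma chain_gap_nonneg: "0 \<le> chain_gap a b n"
  by (simp add: chain_gap_def sum_nonneg)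

text \<open>The means of the end points allow correlations from
  \<open>\<bar>a 1 + b (Suc n)\<bar> - 1\<close> to \<open>1 - \<bar>a 1 - b (Suc n)\<bar>\<close>.
  With budget \<open>chain_gap a b n\<close>, the odd constraint holds at the smallest of these and
  the even constraint at the largest.\<close>

lemma odd_max_even_max_gap:
  assumes "\<bar>a 1\<bar> \<le> 1" "\<bar>b 1\<bar> \<le> 1" "\<And>i. i \<in> {1..n} \<Longrightarrow> cut_triangle (b i) (a (Suc i)) (f i)"
  shows "odd_max f n + \<bar>a 1 + b (Suc n)\<bar> - 1 \<le> 2 * chain_gap a b n + (real n - 1) \<and>
    even_max f n + \<bar>a 1 - b (Suc n)\<bar> - 1 \<le> 2 * chain_gap a b n + (real n - 1)"
  using assms(3)
proof (induction n)
  case 0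
  show ?case using assms(1,2) by (simp add: chain_gap_def)
next
  case (Suc n)
  let ?K = "2 * chain_gap a b n + real n"
  have IH: "odd_max f n + \<bar>a 1 + b (Suc n)\<bar> \<le> ?K" "even_max f n + \<bar>a 1 - b (Suc n)\<bar> \<le> ?K"
    using Suc by auto
  have "odd_max f (Suc n) + \<bar>a 1 + a (Suc (Suc n))\<bar> \<le> ?K + 1"
    "even_max f (Suc n) + \<bar>a 1 - a (Suc (Suc n))\<bar> \<le> ?K + 1"
    using odd_max_even_max_step[OF IH Suc.prems[of "Suc n"]] by simp_all
  moreover have "2 * chain_gap a b (Suc n) = 2 * chain_gap a b n + \<bar>a (Suc (Suc n)) - b (Suc (Suc n))\<bar>"
    by (simp add: chain_gap_Suc)
  moreover have "\<bar>a 1 + b (Suc (Suc n))\<bar> \<le> \<bar>a 1 + a (Suc (Suc n))\<bar> + \<bar>a (Suc (Suc n)) - b (Suc (Suc n))\<bar>"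
    "\<bar>a 1 - b (Suc (Suc n))\<bar> \<le> \<bar>a 1 - a (Suc (Suc n))\<bar> + \<bar>a (Suc (Suc n)) - b (Suc (Suc n))\<bar>"
    by linarith+
  ultimately show ?case by (simp del: odd_max.simps even_max.simps)
qed

text \<open>The chain is \<open>W 1, V 1, W 2, V 2, ..., W (n + 1), V (n + 1)\<close>, with \<open>V\<close> and \<open>W\<close> the first and second
  component of a sample point.\<close>

definition chain_coupling ::
  "(nat \<Rightarrow> real) \<Rightarrow> (nat \<Rightarrow> real) \<Rightarrow> (nat \<Rightarrow> real) \<Rightarrow> nat \<Rightarrow> ((nat \<Rightarrow> int) \<times> (nat \<Rightarrow> int)) pmf \<Rightarrow> bool" where
  "chain_coupling a b f n S \<longleftrightarrow>
    (\<forall>i\<in>{1..Suc n}. pm1 S (\<lambda>s. fst s i) \<and> pm1 S (\<lambda>s. snd s i) \<and>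
       mean S (\<lambda>s. snd s i) = a i \<and> mean S (\<lambda>s. fst s i) = b i) \<and>
    (\<forall>i\<in>{1..n}. corr S (\<lambda>s. fst s i) (\<lambda>s. snd s (Suc i)) = f i)"

text \<open>An edge of correlation \<open>x\<close> closes the chain to a cycle of
  \<open>2 * n + 2\<close> edges, whose products with an odd number of flips sum to at most
  \<open>2 * n\<close>. Subtracting the \<open>n + 1\<close> free edges leaves the constant
  \<open>n - 1\<close> of the last two hypotheses.\<close>

lemma chain_coupling_exists:
  assumes "\<bar>a 1\<bar> \<le> 1" "\<And>i. i \<in> {1..Suc n} \<Longrightarrow> \<bar>b i\<bar> \<le> 1"
    and "\<And>i. i \<in> {1..n} \<Longrightarrow> cut_triangle (b i) (a (Suc i)) (f i)"
    and "cut_triangle (a 1) (b (Suc n)) x" "chain_gap a b n \<le> D"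
    and "odd_max f n + x \<le> 2 * D + (real n - 1)" "even_max f n - x \<le> 2 * D + (real n - 1)"
  shows "\<exists>S :: ((nat \<Rightarrow> int) \<times> (nat \<Rightarrow> int)) pmf. chain_coupling a b f n S \<and>
    corr S (\<lambda>s. snd s 1) (\<lambda>s. fst s (Suc n)) = x \<and>
    (\<Sum>i=1..Suc n. (1 - corr S (\<lambda>s. fst s i) (\<lambda>s. snd s i)) / 2) \<le> D"
  using assms(2-)
proof (induction n arbitrary: x D)
  case 0
  \<comment> \<open>A single free edge: since \<open>even_max f 0 = 0\<close>, the last hypothesis
    says that its cost \<open>(1 - x) / 2\<close> is at most \<open>D\<close>.\<close>
  obtain T :: "(int \<times> int) pmf" where T: "pm1 T fst" "pm1 T snd" "mean T fst = a 1" "mean T snd = b 1"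
    "corr T fst snd = x"
    using pair_exists[OF 0(3)] by auto
  then have "corr T snd fst = x" by (simp add: corr_def mult.commute)
  with T 0 show ?case
    by (intro exI[of _ "map_pmf (\<lambda>(w, v). (\<lambda>_. v, \<lambda>_. w)) T"])
      (simp add: chain_coupling_def pm1_map mean_map corr_map o_def case_prod_beta' field_simps)
next
  case (Suc n)
  let ?k = "Suc (Suc n)"
  have tri: "cut_triangle (b (Suc n)) (a ?k) (f (Suc n))" using Suc.prems(2) by simp
  have f: "\<bar>f i\<bar> \<le> 1" if "i \<in> {1..Suc n}" for i
    using cut_triangleD(9,10)[OF Suc.prems(2)[OF that]] by linarith
  have ak: "\<bar>a ?k\<bar> \<le> 1" using cut_triangleD(7,8)[OF tri] by linarith
  have gap: "odd_max f n + \<bar>a 1 + b (Suc n)\<bar> - 1 \<le> 2 * chain_gap a b n + (real n - 1)"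
     "even_max f n + \<bar>a 1 - b (Suc n)\<bar> - 1 \<le> 2 * chain_gap a b n + (real n - 1)"
    using odd_max_even_max_gap[of a b n f] assms(1) Suc.prems(1)[of 1] Suc.prems(2) by auto
  have gap': "odd_max f (Suc n) + \<bar>a 1 + a ?k\<bar> - 1 \<le> 2 * chain_gap a b n + real n"
     "even_max f (Suc n) + \<bar>a 1 - a ?k\<bar> - 1 \<le> 2 * chain_gap a b n + real n"
    using odd_max_even_max_step[of "odd_max f n" "a 1" "b (Suc n)" "2 * chain_gap a b n + real n" "even_max f n", OF _ _ tri]
      gap by simp_all
  have sums: "odd_max f n + even_max f n \<le> 2 * (real n - 1)"
     "odd_max f (Suc n) + even_max f (Suc n) \<le> 2 * real n"
    using odd_max_even_max_bounds[of n f] odd_max_even_max_bounds[of "Suc n" f] f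
    by (auto simp del: odd_max.simps even_max.simps)
  \<comment> \<open>Targets are computed backwards from \<open>x\<close>. Removing the free edge
    (\<open>W ?k\<close>, \<open>V ?k\<close>) of correlation \<open>z\<close> leaves the target
    \<open>y\<close> for (\<open>W 1\<close>, \<open>W ?k\<close>) and the budget
    \<open>D - (1 - z) / 2\<close>.\<close>
  obtain y z where yz: "cut_triangle (a 1) (a ?k) y" "cut_triangle (a ?k) (b ?k) z" "cut_triangle y z x"
    "2 * chain_gap a b n + 1 - z \<le> 2 * D" "odd_max f (Suc n) + y + 1 - z \<le> 2 * D + real n"
    "even_max f (Suc n) - y + 1 - z \<le> 2 * D + real n"
    using extend_by_free_edge[OF Suc.prems(3) ak _ chain_gap_nonneg sums(2) gap', of D] Suc.prems(4-6)
    unfolding chain_gap_Suc by auto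
  define D' where "D' = D - (1 - z) / 2"
  have D': "chain_gap a b n \<le> D'" "2 * D' = 2 * D - 1 + z" "0 \<le> D'"
    using yz(4) chain_gap_nonneg[of a b n] unfolding D'_def by (simp_all add: field_simps)
  \<comment> \<open>Removing the prescribed edge (\<open>V (Suc n)\<close>, \<open>W ?k\<close>)
    leaves the target \<open>u\<close> for the shorter chain.\<close>
  obtain u where u: "cut_triangle (a 1) (b (Suc n)) u" "cut_triangle u (f (Suc n)) y"
    "odd_max f n + u \<le> 2 * D' + (real n - 1)" "even_max f n - u \<le> 2 * D' + (real n - 1)"
    using extend_by_prescribed_edge[OF tri yz(1) D'(1,3) sums(1) gap] yz(5,6) D'(2) by auto
  obtain S :: "((nat \<Rightarrow> int) \<times> (nat \<Rightarrow> int)) pmf" where S: "chain_coupling a b f n S"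
    "corr S (\<lambda>s. snd s 1) (\<lambda>s. fst s (Suc n)) = u"
    "(\<Sum>i=1..Suc n. (1 - corr S (\<lambda>s. fst s i) (\<lambda>s. snd s i)) / 2) \<le> D'"
    using Suc.IH[OF _ _ u(1) D'(1) u(3,4)] Suc.prems(1,2) by auto
  have S1: "pm1 S (\<lambda>s. snd s 1)" "mean S (\<lambda>s. snd s 1) = a 1"
    "pm1 S (\<lambda>s. fst s (Suc n))" "mean S (\<lambda>s. fst s (Suc n)) = b (Suc n)"
    using S(1) by (auto simp: chain_coupling_def)
  \<comment> \<open>The variables are attached in forward order, \<open>W ?k\<close> in
    \<open>T\<close> and \<open>V ?k\<close> in \<open>U\<close>, each through its correlations with
    \<open>W 1\<close> and with its predecessor.\<close>
  obtain T where T: "map_pmf fst T = S" "pm1 T snd" "mean T snd = a ?k"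
    "corr T ((\<lambda>s. snd s 1) \<circ> fst) snd = y" "corr T ((\<lambda>s. fst s (Suc n)) \<circ> fst) snd = f (Suc n)"
    using extend_by_third_variable[OF S1(1,3), of "a ?k" y "f (Suc n)"] S1 S(2) yz(1) tri u(2) by auto
  have T1: "pm1 T ((\<lambda>s. snd s 1) \<circ> fst)" "mean T ((\<lambda>s. snd s 1) \<circ> fst) = a 1"
    using S1 unfolding T(1)[symmetric] by (simp_all add: pm1_map mean_map)
  obtain U where U: "map_pmf fst U = T" "pm1 U snd" "mean U snd = b ?k"
    "corr U ((\<lambda>s. snd s 1) \<circ> fst \<circ> fst) snd = x" "corr U (snd \<circ> fst) snd = z"
    using extend_by_third_variable[OF T1(1) T(2), of "b ?k" x z] T1 T(3,4) yz(2,3) Suc.prems(3) by auto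
  have US: "S = map_pmf (fst \<circ> fst) U"
    unfolding T(1)[symmetric] U(1)[symmetric] by (simp add: map_pmf_comp o_def)
  define R where "R = map_pmf (\<lambda>t. ((fst (fst (fst t)))(?k := snd t), (snd (fst (fst t)))(?k := snd (fst t)))) U"
  have old: "pm1 R (\<lambda>s. fst s i) = pm1 S (\<lambda>s. fst s i)" "pm1 R (\<lambda>s. snd s i) = pm1 S (\<lambda>s. snd s i)"
    "mean R (\<lambda>s. snd s i) = mean S (\<lambda>s. snd s i)" "mean R (\<lambda>s. fst s i) = mean S (\<lambda>s. fst s i)"
    if "i \<le> Suc n" for i
    using that unfolding R_def US by (simp_all add: pm1_map mean_map o_def)
  have oldc: "corr R (\<lambda>s. fst s i) (\<lambda>s. snd s j) = corr S (\<lambda>s. fst s i) (\<lambda>s. snd s j)"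
    if "i \<le> Suc n" "j \<le> Suc n" for i j
    using that unfolding R_def US by (simp add: corr_map o_def)
  have new: "pm1 R (\<lambda>s. fst s ?k)" "pm1 R (\<lambda>s. snd s ?k)" "mean R (\<lambda>s. snd s ?k) = a ?k"
    "mean R (\<lambda>s. fst s ?k) = b ?k" "corr R (\<lambda>s. fst s (Suc n)) (\<lambda>s. snd s ?k) = f (Suc n)"
    "corr R (\<lambda>s. snd s 1) (\<lambda>s. fst s ?k) = x" "corr R (\<lambda>s. fst s ?k) (\<lambda>s. snd s ?k) = z"
    using U(2-5) T(2,3,5) unfolding U(1)[symmetric] R_def
    by (simp_all add: pm1_map mean_map corr_map o_def) (simp add: corr_def mult.commute)
  have "chain_coupling a b f (Suc n) R"
    unfolding chain_coupling_def
  proof (intro conjI ballI)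
    fix i assume i: "i \<in> {1..Suc (Suc n)}"
    show "pm1 R (\<lambda>s. fst s i)" "pm1 R (\<lambda>s. snd s i)" "mean R (\<lambda>s. snd s i) = a i" "mean R (\<lambda>s. fst s i) = b i"
      using i S(1) old[of i] new(1-4) by (cases "i = ?k"; auto simp: chain_coupling_def)+
  next
    fix i assume i: "i \<in> {1..Suc n}"
    show "corr R (\<lambda>s. fst s i) (\<lambda>s. snd s (Suc i)) = f i"
      using i S(1) oldc[of i "Suc i"] new(5) by (cases "i = Suc n"; auto simp: chain_coupling_def)
  qed
  moreover have "(\<Sum>i=1..Suc (Suc n). (1 - corr R (\<lambda>s. fst s i) (\<lambda>s. snd s i)) / 2) \<le> D"
  proof -
    have "(\<Sum>i=1..Suc n. (1 - corr R (\<lambda>s. fst s i) (\<lambda>s. snd s i)) / 2) =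
      (\<Sum>i=1..Suc n. (1 - corr S (\<lambda>s. fst s i) (\<lambda>s. snd s i)) / 2)"
      by (intro sum.cong) (auto simp: oldc)
    then show ?thesis using S(3) new(7) by (simp add: D'_def)
  qed
  ultimately show ?case using new(6) by blast
qed

section \<open>KCBS systems\<close>

lemma distribution_eqI:
  assumes "pm1 S X" "pm1 T X'" "mean S X = mean T X'"
  shows "map_pmf X S = map_pmf X' T"
proof -
  have sq: "corr R Y Y = 1" if "pm1 R Y" for R :: "'c pmf" and Y
  proof -
    have "corr R Y Y = mean R (\<lambda>_. 1)"
      unfolding corr_def using that by (intro mean_cong) (auto simp: pm1_def)
    then show ?thesis by (simp add: mean_def)
  qed
  \<comment> \<open>A single variable is treated as the pair of itself with itself, of correlation
    1.\<close>
  have "map_pmf (\<lambda>s. (X s, X s)) S = map_pmf (\<lambda>t. (X' t, X' t)) T"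
    using assms by (intro pair_distribution_eqI) (simp_all add: sq)
  then have "map_pmf fst (map_pmf (\<lambda>s. (X s, X s)) S) = map_pmf fst (map_pmf (\<lambda>t. (X' t, X' t)) T)"
    by simp
  then show ?thesis by (simp add: map_pmf_comp)
qed

text \<open>Half the distance of the means bounds the mismatch of any coupling from below, and a
  pair with the largest correlation allowed, \<open>1 - \<bar>expec A - expec B\<bar>\<close>,
  attains it.\<close>

lemma is_maximal_coupling_iff:
  assumes "set_pmf A \<subseteq> {-1, 1}" "set_pmf B \<subseteq> {-1, 1}"
  shows "is_maximal_coupling Q A B \<longleftrightarrow> is_coupling Q A B \<and>
    measure_pmf.prob Q {x. fst x \<noteq> snd x} = \<bar>expec A - expec B\<bar> / 2"
proof -
  have compl: "measure_pmf.prob Q {x. fst x = snd x} = 1 - measure_pmf.prob Q {x. fst x \<noteq> snd x}"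
    for Q :: "(int \<times> int) pmf"
    using measure_pmf.prob_compl[of "{x. fst x \<noteq> snd x}" Q]
    by (simp add: Compl_eq_Diff_UNIV[symmetric] Collect_neg_eq[symmetric])
  have lower: "\<bar>expec A - expec B\<bar> / 2 \<le> measure_pmf.prob Q {x. fst x \<noteq> snd x}"
    if "is_coupling Q A B" for Q
  proof -
    from that have AB: "A = map_pmf fst Q" "B = map_pmf snd Q" by (auto simp: is_coupling_def)
    have pm: "pm1 Q fst" "pm1 Q snd" using assms unfolding AB by (auto simp: pm1_def)
    show ?thesis
      using cut_triangle_mean_corr[OF pm] unfolding prob_neq_eq[OF pm] AB
      by (simp add: expec_def mean_def cut_triangle_def)
  qed
  have pm: "pm1 A (\<lambda>x. x)" "pm1 B (\<lambda>x. x)" using assms by (auto simp: pm1_def)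
  have e: "expec A = mean A (\<lambda>x. x)" "expec B = mean B (\<lambda>x. x)" by (simp_all add: expec_def mean_def)
  have "\<bar>expec A\<bar> \<le> 1" "\<bar>expec B\<bar> \<le> 1"
    using cut_triangleD(5,6)[OF cut_triangle_mean_corr[OF pm(1) pm(1)]]
      cut_triangleD(5,6)[OF cut_triangle_mean_corr[OF pm(2) pm(2)]] unfolding e by linarith+
  then have "cut_triangle (expec A) (expec B) (1 - \<bar>expec A - expec B\<bar>)"
    unfolding cut_triangle_def by linarith
  from pair_exists[OF this] obtain T :: "(int \<times> int) pmf" where
    T: "pm1 T fst" "pm1 T snd" "mean T fst = expec A" "mean T snd = expec B"
      "corr T fst snd = 1 - \<bar>expec A - expec B\<bar>" by auto
  have "map_pmf fst T = map_pmf (\<lambda>x. x) A" "map_pmf snd T = map_pmf (\<lambda>x. x) B"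
    using distribution_eqI[OF T(1) pm(1)] distribution_eqI[OF T(2) pm(2)] T(3,4) unfolding e by blast+
  then have "is_coupling T A B" by (simp add: is_coupling_def map_pmf_ident)
  moreover have "measure_pmf.prob T {x. fst x \<noteq> snd x} = \<bar>expec A - expec B\<bar> / 2"
    using prob_neq_eq[OF T(1,2)] T(5) by simp
  ultimately show ?thesis
    unfolding is_maximal_coupling_def compl using lower by (smt (verit))
qed

text \<open>Some pair has opposite signs and contributes 0; each other pair contributes at most
  2.\<close>

lemma sum_pairs_le_of_prod:
  fixes x y :: "'a \<Rightarrow> int"
  assumes "finite A" "\<And>i. i \<in> A \<Longrightarrow> x i \<in> {-1, 1} \<and> y i \<in> {-1, 1}" "(\<Prod>i\<in>A. x i * y i) = -1"
  shows "(\<Sum>i\<in>A. x i + y i) \<le> 2 * int (card A) - 2"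
proof -
  obtain i where i: "i \<in> A" "x i * y i \<noteq> 1"
    using assms(3) prod.neutral[of A "\<lambda>i. x i * y i"] by (metis one_neq_neg_one)
  then have "x i + y i = 0" using assms(2)[OF i(1)] by auto
  then have "(\<Sum>i\<in>A. x i + y i) = (\<Sum>i\<in>A - {i}. x i + y i)"
    using i assms(1) by (simp add: sum.remove)
  also have "\<dots> \<le> (\<Sum>i\<in>A - {i}. 2)" using assms(2) by (intro sum_mono) force
  also have "\<dots> = 2 * int (card A) - 2"
    using card.remove[OF assms(1) i(1)] by simp
  finally show ?thesis .
qed

text \<open>Links the recursion to the sums in \<open>s_odd5\<close>. The induction starts at one
  summand because -2 is no signed sum; \<open>\<bar>f 1\<bar> \<le> 1\<close> makes it lose both
  first maxima.\<close>

lemma odd_max_even_max_attained: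
  assumes "\<bar>f 1\<bar> \<le> 1"
  shows "(\<exists>M\<subseteq>{1..Suc n}. odd (card M) \<and>
      odd_max f (Suc n) = (\<Sum>i=1..Suc n. if i \<in> M then - f i else f i)) \<and>
    (\<exists>M\<subseteq>{1..Suc n}. even (card M) \<and>
      even_max f (Suc n) = (\<Sum>i=1..Suc n. if i \<in> M then - f i else f i))"
proof (induction n)
  case 0
  have "odd_max f (Suc 0) = - f 1" "even_max f (Suc 0) = f 1" using assms by auto
  then show ?case by (intro conjI exI[of _ "{1}"] exI[of _ "{}"]) auto
next
  case (Suc n)
  let ?s = "\<lambda>M n. \<Sum>i=1..n. if i \<in> M then - f i else f i"
  have ins: "?s (insert (Suc (Suc n)) M) (Suc (Suc n)) = ?s M (Suc n) - f (Suc (Suc n))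
      \<and> card (insert (Suc (Suc n)) M) = Suc (card M) \<and> insert (Suc (Suc n)) M \<subseteq> {1..Suc (Suc n)}"
     and keep: "?s M (Suc (Suc n)) = ?s M (Suc n) + f (Suc (Suc n)) \<and> M \<subseteq> {1..Suc (Suc n)}"
    if M: "M \<subseteq> {1..Suc n}" for M
  proof -
    have "Suc (Suc n) \<notin> M" "finite M" using M by (auto intro: finite_subset)
    moreover have "?s (insert (Suc (Suc n)) M) (Suc n) = ?s M (Suc n)" by (intro sum.cong) auto
    ultimately show "?s (insert (Suc (Suc n)) M) (Suc (Suc n)) = ?s M (Suc n) - f (Suc (Suc n))
      \<and> card (insert (Suc (Suc n)) M) = Suc (card M) \<and> insert (Suc (Suc n)) M \<subseteq> {1..Suc (Suc n)}"
      "?s M (Suc (Suc n)) = ?s M (Suc n) + f (Suc (Suc n)) \<and> M \<subseteq> {1..Suc (Suc n)}"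
      using M by auto
  qed
  obtain M N where M: "M \<subseteq> {1..Suc n}" "odd (card M)" "odd_max f (Suc n) = ?s M (Suc n)"
    and N: "N \<subseteq> {1..Suc n}" "even (card N)" "even_max f (Suc n) = ?s N (Suc n)"
    using Suc by blast
  have "\<exists>M\<subseteq>{1..Suc (Suc n)}. odd (card M) \<and> odd_max f (Suc (Suc n)) = ?s M (Suc (Suc n))"
  proof (cases "even_max f (Suc n) - f (Suc (Suc n)) \<le> odd_max f (Suc n) + f (Suc (Suc n))")
    case True
    then have "odd_max f (Suc (Suc n)) = ?s M (Suc (Suc n))"
      using keep[OF M(1)] M(3) unfolding odd_max.simps(2)[of f "Suc n"] by linarith
    then show ?thesis using keep[OF M(1)] M(2) by blast
  next
    case False
    then have "odd_max f (Suc (Suc n)) = ?s (insert (Suc (Suc n)) N) (Suc (Suc n))"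
      using ins[OF N(1)] N(3) unfolding odd_max.simps(2)[of f "Suc n"] by linarith
    then show ?thesis using ins[OF N(1)] N(2) by (intro exI[of _ "insert (Suc (Suc n)) N"]) simp
  qed
  moreover have "\<exists>M\<subseteq>{1..Suc (Suc n)}. even (card M) \<and> even_max f (Suc (Suc n)) = ?s M (Suc (Suc n))"
  proof (cases "odd_max f (Suc n) - f (Suc (Suc n)) \<le> even_max f (Suc n) + f (Suc (Suc n))")
    case True
    then have "even_max f (Suc (Suc n)) = ?s N (Suc (Suc n))"
      using keep[OF N(1)] N(3) unfolding even_max.simps(2)[of f "Suc n"] by linarith
    then show ?thesis using keep[OF N(1)] N(2) by blast
  next
    case False
    then have "even_max f (Suc (Suc n)) = ?s (insert (Suc (Suc n)) M) (Suc (Suc n))"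
      using ins[OF M(1)] M(3) unfolding even_max.simps(2)[of f "Suc n"] by linarith
    then show ?thesis using ins[OF M(1)] M(2) by (intro exI[of _ "insert (Suc (Suc n)) M"]) simp
  qed
  ultimately show ?case by blast
qed

lemma odd_max_le_s_odd5:
  assumes "\<bar>f 1\<bar> \<le> 1"
  shows "odd_max f 5 \<le> s_odd5 f"
proof -
  obtain M where "M \<subseteq> {1..Suc 4}" "odd (card M)"
    "odd_max f (Suc 4) = (\<Sum>i=1..Suc 4. if i \<in> M then - f i else f i)"
    using odd_max_even_max_attained[where f = f and n = 4, OF assms] by blast
  then show ?thesis
    unfolding s_odd5_def by (intro Max_ge) (auto simp: numeral_eq_Suc simp del: sum.cl_ivl_Suc odd_max.simps)
qed

section \<open>Cyclic indices and the moments of a KCBS system\<close>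

lemma cyc5_in: "i \<in> {1..5} \<Longrightarrow> cyc5 i \<in> {1..5}"
  by (auto simp: cyc5_def)

lemma cyc5_pred_in: "i \<in> {1..5} \<Longrightarrow> cyc5_pred i \<in> {1..5}"
  by (auto simp: cyc5_pred_def)

lemma cyc5_cyc5_pred: "i \<in> {1..5} \<Longrightarrow> cyc5 (cyc5_pred i) = i"
  by (auto simp: cyc5_pred_def cyc5_def)

lemma cyc5_pred_cyc5: "i \<in> {1..5} \<Longrightarrow> cyc5_pred (cyc5 i) = i"
  by (auto simp: cyc5_pred_def cyc5_def)

lemma bij_betw_cyc5: "bij_betw cyc5 {1..5} {1..5}"
  by (rule bij_betw_byWitness[where f' = cyc5_pred];
    use cyc5_in cyc5_pred_in cyc5_cyc5_pred cyc5_pred_cyc5 in blast)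

lemma kcbs_moments:
  assumes "kcbs_system P" "i \<in> {1..5}"
  shows "pm1 (P i) fst" "pm1 (P i) snd" "expec (Vdist P i) = mean (P i) fst"
    "expec (Wdist P (cyc5 i)) = mean (P i) snd" "prod_expec P i = corr (P i) fst snd"
    "cut_triangle (expec (Vdist P i)) (expec (Wdist P (cyc5 i))) (prod_expec P i)"
proof -
  have "set_pmf (P i) \<subseteq> {-1, 1} \<times> {-1, 1}" using assms by (auto simp: kcbs_system_def)
  then show pm: "pm1 (P i) fst" "pm1 (P i) snd" by (auto simp: pm1_def)
  show "expec (Vdist P i) = mean (P i) fst" "expec (Wdist P (cyc5 i)) = mean (P i) snd"
    "prod_expec P i = corr (P i) fst snd"
    using assms(2) by (simp_all add: expec_def Vdist_def Wdist_def mean_def cyc5_pred_cyc5 prod_expec_def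
      corr_def case_prod_beta')
  then show "cut_triangle (expec (Vdist P i)) (expec (Wdist P (cyc5 i))) (prod_expec P i)"
    using cut_triangle_mean_corr[OF pm] by simp
qed

lemma system_coupling_moments:
  assumes "kcbs_system P" "system_coupling P S" "i \<in> {1..5}"
  shows "pm1 S (\<lambda>s. fst s i)" "pm1 S (\<lambda>s. snd s i)"
    "mean S (\<lambda>s. fst s i) = expec (Vdist P i)" "mean S (\<lambda>s. snd s i) = expec (Wdist P i)"
    "corr S (\<lambda>s. fst s i) (\<lambda>s. snd s (cyc5 i)) = prod_expec P i"
    "Vdist P i = map_pmf (\<lambda>s. fst s i) S" "Wdist P i = map_pmf (\<lambda>s. snd s i) S"
proof -
  have eq: "P j = map_pmf (\<lambda>s. (fst s j, snd s (cyc5 j))) S" if "j \<in> {1..5}" for j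
    using assms(2) that by (simp add: system_coupling_def case_prod_beta')
  \<comment> \<open>\<open>W i\<close> is the second component of the pair with index
    \<open>cyc5_pred i\<close>.\<close>
  note pred = cyc5_pred_in[OF assms(3)] cyc5_cyc5_pred[OF assms(3)]
  show "pm1 S (\<lambda>s. fst s i)"
    using kcbs_moments(1)[OF assms(1,3)] unfolding eq[OF assms(3)] by (simp add: pm1_map o_def)
  show "pm1 S (\<lambda>s. snd s i)"
    using kcbs_moments(2)[OF assms(1) pred(1)] unfolding eq[OF pred(1)] by (simp add: pm1_map o_def pred)
  show "mean S (\<lambda>s. fst s i) = expec (Vdist P i)"
    unfolding kcbs_moments(3)[OF assms(1,3)] eq[OF assms(3)] by (simp add: mean_map o_def)
  show "mean S (\<lambda>s. snd s i) = expec (Wdist P i)"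
    using kcbs_moments(4)[OF assms(1) pred(1)] unfolding pred eq[OF pred(1)] by (simp add: mean_map o_def pred)
  show "corr S (\<lambda>s. fst s i) (\<lambda>s. snd s (cyc5 i)) = prod_expec P i"
    unfolding kcbs_moments(5)[OF assms(1,3)] eq[OF assms(3)] by (simp add: corr_map o_def)
  show "Vdist P i = map_pmf (\<lambda>s. fst s i) S"
    unfolding Vdist_def eq[OF assms(3)] by (simp add: map_pmf_comp)
  show "Wdist P i = map_pmf (\<lambda>s. snd s i) S"
    unfolding Wdist_def eq[OF pred(1)] by (simp add: map_pmf_comp pred)
qed

section \<open>Lower bounds on the mismatch\<close>

lemma s_odd5_le_mismatch:
  assumes P: "kcbs_system P" and S: "system_coupling P S"
  shows "s_odd5 (prod_expec P) - 3 \<le> 2 * (\<Sum>i=1..5. measure_pmf.prob S {x. fst x i \<noteq> snd x i})"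
proof -
  note mom = system_coupling_moments[OF P S]
  define C where "C i = corr S (\<lambda>s. fst s i) (\<lambda>s. snd s i)" for i
  have prob: "(\<Sum>i=1..5. measure_pmf.prob S {x. fst x i \<noteq> snd x i}) = (\<Sum>i=1..5. (1 - C i) / 2)"
    using mom by (intro sum.cong) (auto simp: prob_neq_eq C_def)
  have "(\<Sum>i=1..5. if i \<in> M then - prod_expec P i else prod_expec P i) + (\<Sum>i=1..5. C i) \<le> 8"
    if M: "M \<subseteq> {1..5}" "odd (card M)" for M
  proof -
    define \<sigma> :: "nat \<Rightarrow> int" where "\<sigma> i = (if i \<in> M then -1 else 1)" for i
    have "(\<Prod>i\<in>{1..5}. \<sigma> i) = (\<Prod>i\<in>M. -1)"
      using M(1) unfolding \<sigma>_def by (simp add: prod.If_cases Int_absorb1)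
    then have \<sigma>: "(\<Prod>i\<in>{1..5}. \<sigma> i) = -1" using M(2) by simp
    have int: "integrable (measure_pmf S) (\<lambda>s. real_of_int (fst s i * snd s j))"
      if "i \<in> {1..5}" "j \<in> {1..5}" for i j
      using mom(1)[OF that(1)] mom(2)[OF that(2)] by (intro integrable_pm1 pm1_mult)
    let ?t = "\<lambda>s. \<Sum>i=1..5. \<sigma> i * (fst s i * snd s (cyc5 i)) + fst s i * snd s i"
    \<comment> \<open>The ten signed products around the cycle multiply to \<open>-1\<close>, so one of them is \<open>-1\<close>.\<close>
    have bound: "?t s \<le> 8" if s: "s \<in> set_pmf S" for s
    proof -
      have pm: "fst s i \<in> {-1, 1}" "snd s i \<in> {-1, 1}" if "i \<in> {1..5}" for i
        using mom(1,2)[OF that] s by (auto simp: pm1_def)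
      have sq: "(\<Prod>i=1..5. snd s i) * (\<Prod>i=1..5. snd s i) = 1"
        unfolding prod.distrib[symmetric]
      proof (intro prod.neutral ballI)
        show "snd s i * snd s i = 1" if "i \<in> {1..5}" for i using pm(2)[OF that] by auto
      qed
      \<comment> \<open>Factor \<open>i\<close> holds both edges at \<open>V i\<close>, so
        \<open>V i\<close> squares away. Each \<open>W i\<close> is then left twice, as
        \<open>cyc5\<close> permutes the indices.\<close>
      have "(\<Prod>i=1..5. \<sigma> i * (fst s i * snd s (cyc5 i)) * (fst s i * snd s i)) =
        (\<Prod>i=1..5. \<sigma> i * (snd s (cyc5 i) * snd s i))"
      proof (rule prod.cong[OF refl])
        show "\<sigma> i * (fst s i * snd s (cyc5 i)) * (fst s i * snd s i) = \<sigma> i * (snd s (cyc5 i) * snd s i)"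
          if "i \<in> {1..5}" for i
          using pm(1)[OF that] by auto
      qed
      also have "\<dots> = (\<Prod>i=1..5. \<sigma> i) * ((\<Prod>i=1..5. snd s (cyc5 i)) * (\<Prod>i=1..5. snd s i))"
        by (simp only: prod.distrib)
      also have "(\<Prod>i=1..5. snd s (cyc5 i)) = (\<Prod>i=1..5. snd s i)"
        by (rule prod.reindex_bij_betw[OF bij_betw_cyc5])
      finally have "(\<Prod>i=1..5. \<sigma> i * (fst s i * snd s (cyc5 i)) * (fst s i * snd s i)) = -1"
        using \<sigma> sq by simp
      then have "?t s \<le> 2 * int (card {1..5::nat}) - 2"
      proof (intro sum_pairs_le_of_prod)
        fix i :: nat assume i: "i \<in> {1..5}"
        show "\<sigma> i * (fst s i * snd s (cyc5 i)) \<in> {-1, 1} \<and> fst s i * snd s i \<in> {-1, 1}"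
          using pm[OF i] pm(2)[OF cyc5_in[OF i]] by (auto simp: \<sigma>_def)
      qed simp_all
      then show ?thesis by simp
    qed
    have "(\<Sum>i=1..5. if i \<in> M then - prod_expec P i else prod_expec P i) + (\<Sum>i=1..5. C i)
      = (\<Sum>i=1..5. real_of_int (\<sigma> i) * prod_expec P i + C i)"
      unfolding sum.distrib \<sigma>_def by (intro arg_cong2[where f = "(+)"] sum.cong) auto
    also have "\<dots> = (\<Sum>i=1..5. measure_pmf.expectation S (\<lambda>s. real_of_int (\<sigma> i) *
        real_of_int (fst s i * snd s (cyc5 i)) + real_of_int (fst s i * snd s i)))"
    proof (rule sum.cong[OF refl])
      fix i :: nat assume i: "i \<in> {1..5}"
      show "real_of_int (\<sigma> i) * prod_expec P i + C i = measure_pmf.expectation S (\<lambda>s. real_of_int (\<sigma> i) *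
        real_of_int (fst s i * snd s (cyc5 i)) + real_of_int (fst s i * snd s i))"
        using int[OF i i] int[OF i cyc5_in[OF i]] unfolding mom(5)[OF i, symmetric] C_def corr_def mean_def
        by (subst Bochner_Integration.integral_add) (simp_all del: of_int_mult)
    qed
    also have "\<dots> = measure_pmf.expectation S (\<lambda>s. \<Sum>i=1..5. real_of_int (\<sigma> i) *
        real_of_int (fst s i * snd s (cyc5 i)) + real_of_int (fst s i * snd s i))"
      using int cyc5_in by (intro Bochner_Integration.integral_sum[symmetric] Bochner_Integration.integrable_add
        integrable_mult_right) blast+
    also have "\<dots> = measure_pmf.expectation S (\<lambda>s. real_of_int (?t s))" by simp
    also have "\<dots> \<le> 8"
    proof (rule measure_pmf.integral_le_const)
      have "integrable (measure_pmf S) (\<lambda>s. \<Sum>i=1..5. real_of_int (\<sigma> i) *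
        real_of_int (fst s i * snd s (cyc5 i)) + real_of_int (fst s i * snd s i))"
        using int cyc5_in by (intro Bochner_Integration.integrable_sum Bochner_Integration.integrable_add
          integrable_mult_right) blast+
      then show "integrable (measure_pmf S) (\<lambda>s. real_of_int (?t s))" by simp
      have "real_of_int (?t s) \<le> 8" if "s \<in> set_pmf S" for s
        using bound[OF that] by linarith
      then show "AE s in measure_pmf S. real_of_int (?t s) \<le> 8" unfolding AE_measure_pmf_iff by blast
    qed
    finally show ?thesis .
  qed
  moreover have "s_odd5 (prod_expec P) \<in> (\<lambda>M. \<Sum>i=1..5. if i \<in> M then - prod_expec P i else prod_expec P i)
                    ` {M. M \<subseteq> {1..5} \<and> odd (card M)}"
    unfolding s_odd5_def
  proof (rule Max_in)
    show "(\<lambda>M. \<Sum>i=1..5. if i \<in> M then - prod_expec P i else prod_expec P i) `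
      {M. M \<subseteq> {1..5} \<and> odd (card M)} \<noteq> {}"
      using exI[of "\<lambda>M. M \<subseteq> {1..5} \<and> odd (card M)" "{1::nat}"] by auto
  qed simp
  ultimately have "s_odd5 (prod_expec P) + (\<Sum>i=1..5. C i) \<le> 8" by auto
  \<comment> \<open>The constant 3 of the bound arises as 8 - 5.\<close>
  moreover have "2 * (\<Sum>i=1..5. (1 - C i) / 2) = 5 - (\<Sum>i=1..5. C i)"
    by (simp add: sum_divide_distrib[symmetric] sum_subtractf)
  ultimately show ?thesis unfolding prob by linarith
qed

lemma mismatch_ge:
  assumes P: "kcbs_system P" and S: "system_coupling P S" and i: "i \<in> {1..5}"
  shows "\<bar>expec (Vdist P i) - expec (Wdist P i)\<bar> / 2 \<le> measure_pmf.prob S {x. fst x i \<noteq> snd x i}"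
  using cut_triangle_mean_corr[OF system_coupling_moments(1,2)[OF P S i]]
  unfolding prob_neq_eq[OF system_coupling_moments(1,2)[OF P S i]] system_coupling_moments(3,4)[OF P S i]
  by (simp add: cut_triangle_def)

section \<open>Attainment of the lower bound\<close>

lemma optimal_system_coupling_exists:
  assumes P: "kcbs_system P"
  shows "\<exists>S. system_coupling P S \<and> (\<Sum>i=1..5. measure_pmf.prob S {x. fst x i \<noteq> snd x i})
    \<le> (1/2) * max (2 * Delta0 P) (s_odd5 (prod_expec P) - 3)"
proof -
  define D where "D = (1/2) * max (2 * Delta0 P) (s_odd5 (prod_expec P) - 3)"
  define a b f where "a i = expec (Wdist P i)" and "b i = expec (Vdist P i)" and "f = prod_expec P" for i
  note mom = kcbs_moments[OF P]
  have tri: "cut_triangle (b i) (a (cyc5 i)) (f i)" if "i \<in> {1..5}" for i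
    using mom(6)[OF that] by (simp add: a_def b_def f_def)
  have tri5: "cut_triangle (a 1) (b (Suc 4)) (f 5)"
    using tri[of 5] by (subst cut_triangle_commute) (simp add: cyc5_def)
  have b: "\<bar>b i\<bar> \<le> 1" if "i \<in> {1..5}" for i using cut_triangleD(5,6)[OF tri[OF that]] by linarith
  have a1: "\<bar>a 1\<bar> \<le> 1" using cut_triangleD(5,6)[OF tri5] by linarith
  have f1: "\<bar>f 1\<bar> \<le> 1" using cut_triangleD(9,10)[OF tri[of 1]] by simp
  have "odd_max f 5 \<le> 2 * D + 3"
    using odd_max_le_s_odd5[of f, OF f1] by (simp add: D_def f_def)
  \<comment> \<open>Unfolding the last step of the recursion yields exactly the two conditions on
    the closing correlation \<open>f 5\<close>.\<close>
  moreover have "odd_max f 5 = max (odd_max f 4 + f 5) (even_max f 4 - f 5)"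
    using odd_max.simps(2)[of f 4] by simp
  ultimately have le: "odd_max f 4 + f 5 \<le> 2 * D + (real 4 - 1)" "even_max f 4 - f 5 \<le> 2 * D + (real 4 - 1)"
    by simp_all
  have gap: "chain_gap a b 4 \<le> D"
    by (simp add: chain_gap_def D_def Delta0_def a_def b_def abs_minus_commute)
  have step: "cut_triangle (b i) (a (Suc i)) (f i)" if "i \<in> {1..4}" for i
    using tri[of i] that by (simp add: cyc5_def)
  obtain S :: "((nat \<Rightarrow> int) \<times> (nat \<Rightarrow> int)) pmf" where S: "chain_coupling a b f 4 S"
    "corr S (\<lambda>s. snd s 1) (\<lambda>s. fst s (Suc 4)) = f 5"
    "(\<Sum>i=1..Suc 4. (1 - corr S (\<lambda>s. fst s i) (\<lambda>s. snd s i)) / 2) \<le> D"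
    using chain_coupling_exists[OF a1 _ step tri5 gap le] b by auto
  have pm: "pm1 S (\<lambda>s. fst s i)" "pm1 S (\<lambda>s. snd s i)" "mean S (\<lambda>s. snd s i) = a i" "mean S (\<lambda>s. fst s i) = b i"
    if "i \<in> {1..5}" for i
    using S(1) that by (auto simp: chain_coupling_def)
  have corr: "corr S (\<lambda>s. fst s i) (\<lambda>s. snd s (cyc5 i)) = f i" if "i \<in> {1..5}" for i
  proof (cases "i = 5")
    case True
    then show ?thesis using S(2) by (simp add: cyc5_def corr_def mult.commute)
  next
    case False
    then show ?thesis using S(1) that by (auto simp: chain_coupling_def cyc5_def)
  qed
  have "map_pmf (\<lambda>s. (fst s i, snd s (cyc5 i))) S = P i" if i: "i \<in> {1..5}" for i
  proof -
    have "map_pmf (\<lambda>s. (fst s i, snd s (cyc5 i))) S = map_pmf (\<lambda>t. (fst t, snd t)) (P i)"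
      using pm[OF i] pm[OF cyc5_in[OF i]] corr[OF i] mom(1-5)[OF i]
      by (intro pair_distribution_eqI) (simp_all add: a_def b_def f_def)
    then show ?thesis by (simp add: map_pmf_ident)
  qed
  then have "system_coupling P S" by (simp add: system_coupling_def case_prod_beta')
  moreover have "(\<Sum>i=1..5. measure_pmf.prob S {x. fst x i \<noteq> snd x i}) =
      (\<Sum>i=1..Suc 4. (1 - corr S (\<lambda>s. fst s i) (\<lambda>s. snd s i)) / 2)"
    using pm by (intro sum.cong) (auto simp: prob_neq_eq)
  ultimately show ?thesis using S(3) unfolding D_def by auto
qed

theorem theorem31:
  fixes P :: "nat \<Rightarrow> (int \<times> int) pmf"
  assumes "kcbs_system P"
  shows "Delta0 P = (1/2) * (\<Sum>i=1..5. \<bar>expec (Vdist P i) - expec (Wdist P i)\<bar>)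
    \<and> Delta_min P = (1/2) * max (2 * Delta0 P) (s_odd5 (prod_expec P) - 3)
    \<and> CNTX P = (1/2) * max 0 (s_odd5 (prod_expec P) - 3
                    - (\<Sum>i=1..5. \<bar>expec (Vdist P i) - expec (Wdist P i)\<bar>))
    \<and> (noncontextual P \<longleftrightarrow>
         s_odd5 (prod_expec P) \<le> 3 + (\<Sum>i=1..5. \<bar>expec (Vdist P i) - expec (Wdist P i)\<bar>))"
proof -
  let ?m = "\<lambda>S i. measure_pmf.prob S {x. fst x i \<noteq> snd x i}"
  let ?gap = "\<Sum>i=1..5. \<bar>expec (Vdist P i) - expec (Wdist P i)\<bar>"
  define D where "D = (1/2) * max (2 * Delta0 P) (s_odd5 (prod_expec P) - 3)"
  have D0: "2 * Delta0 P = ?gap" by (simp add: Delta0_def)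
  note ge = mismatch_ge[OF assms]
  have lower: "D \<le> (\<Sum>i=1..5. ?m S i)" if S: "system_coupling P S" for S
  proof -
    have "Delta0 P = (\<Sum>i=1..5. \<bar>expec (Vdist P i) - expec (Wdist P i)\<bar> / 2)"
      by (simp add: Delta0_def sum_divide_distrib)
    also have "\<dots> \<le> (\<Sum>i=1..5. ?m S i)" by (intro sum_mono ge[OF S])
    finally show ?thesis using s_odd5_le_mismatch[OF assms S] by (simp add: D_def)
  qed
  obtain S where S: "system_coupling P S" "(\<Sum>i=1..5. ?m S i) \<le> D"
    using optimal_system_coupling_exists[OF assms] unfolding D_def by blast
  then have SD: "(\<Sum>i=1..5. ?m S i) = D" using lower by (intro antisym)
  have min: "Delta_min P = D"
    unfolding Delta_min_def
    by (rule cInf_eq_minimum) (use S(1) SD lower in auto)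
  have dist: "set_pmf (Vdist P i) \<subseteq> {-1, 1}" "set_pmf (Wdist P i) \<subseteq> {-1, 1}" if "i \<in> {1..5}" for i
    using kcbs_moments(1)[OF assms that] kcbs_moments(2)[OF assms cyc5_pred_in[OF that]]
    by (auto simp: Vdist_def Wdist_def pm1_def)
  have maximal: "is_maximal_coupling (map_pmf (\<lambda>(v, w). (v i, w i)) S) (Vdist P i) (Wdist P i) \<longleftrightarrow>
      ?m S i = \<bar>expec (Vdist P i) - expec (Wdist P i)\<bar> / 2"
    if S: "system_coupling P S" and i: "i \<in> {1..5}" for S i
    unfolding is_maximal_coupling_iff[OF dist[OF i]]
    by (simp add: is_coupling_def system_coupling_moments(6,7)[OF assms S i] map_pmf_comp
      case_prod_beta' vimage_def)
  have "noncontextual P \<longleftrightarrow> s_odd5 (prod_expec P) \<le> 3 + ?gap"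
  proof
    assume "noncontextual P"
    then obtain S where S: "system_coupling P S"
      "\<forall>i\<in>{1..5}. is_maximal_coupling (map_pmf (\<lambda>(v, w). (v i, w i)) S) (Vdist P i) (Wdist P i)"
      unfolding noncontextual_def by blast
    then have "(\<Sum>i=1..5. ?m S i) = (\<Sum>i=1..5. \<bar>expec (Vdist P i) - expec (Wdist P i)\<bar> / 2)"
      by (intro sum.cong) (auto simp: maximal)
    then show "s_odd5 (prod_expec P) \<le> 3 + ?gap"
      using s_odd5_le_mismatch[OF assms S(1)] by (simp add: sum_divide_distrib[symmetric])
  next
    assume "s_odd5 (prod_expec P) \<le> 3 + ?gap"
    then have "(\<Sum>i=1..5. \<bar>expec (Vdist P i) - expec (Wdist P i)\<bar> / 2) = (\<Sum>i=1..5. ?m S i)"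
      using D0 unfolding SD D_def by (simp add: sum_divide_distrib[symmetric])
    \<comment> \<open>The totals agree and \<open>ge\<close> compares them term by term, so each
      free pair attains its own minimum.\<close>
    then have "\<bar>expec (Vdist P i) - expec (Wdist P i)\<bar> / 2 = ?m S i" if "i \<in> {1..5}" for i
      using sum_mono_inv[OF _ ge[OF S(1)] that] by simp
    then show "noncontextual P"
      unfolding noncontextual_def using S(1) maximal[OF S(1)] by auto
  qed
  moreover have "CNTX P = (1/2) * max 0 (s_odd5 (prod_expec P) - 3 - ?gap)"
    unfolding CNTX_def min D_def using D0 by (simp add: max_def)
  ultimately show ?thesis using min by (simp add: D_def Delta0_def)
qed

end
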